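(* Let $(\Omega,\Sigma)$ be a measurable space and let $X$ be a real Banach space containing no subspace isomorphic to $c_0(\omega_1)$. Let $Z\subseteq X^*$ be a norming subspace. Let $M:\Sigma\to b(X)$ be a map such that $s(x^*,M)\in{\rm ca}(\Sigma)$ for every $x^*\in Z$. Then $M$ admits a control measure.
   Context: By a subspace of a Banach space is meant a norm-closed linear subspace; isomorphic means linearly homeomorphic; $\omega_1$ is the first uncountable ordinal. $B_{X^*}$ is the closed unit ball of the dual $X^*$. A subspace $Z\subseteq X^*$ is norming if the formula $|||x|||=\sup\{|x^*(x)|: x^*\in Z\cap B_{X^*}\}$ ($x\in X$) defines an equivalent norm on $X$. $b(X)$ is the family of all bounded non-empty subsets of $X$. For $C\in b(X)$ and $x^*\in X^*$, $s(x^*,C):=\sup\{x^*(x): x\in C\}$; for a map $M:\Sigma\to b(X)$, $s(x^*,M):\Sigma\to\mathbb{R}$ is defined by $s(x^*,M)(A):=s(x^*,M(A))$. ${\rm ca}(\Sigma)$ is the set of all countably additive real-valued (signed, finite) measures on $\Sigma$, and ${\rm ca}^+(\Sigma)$ is the subset of finite non-negative measures. A measure $\mu\in{\rm ca}^+(\Sigma)$ is a control measure of $M$ if $M(A)=\{0\}$ for every $A\in\Sigma$ with $\mu(A)=0$. *)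

theory Defs
  imports "HOL-Analysis.Analysis" "HOL-Probability.Discrete_Topology"
begin

section \<open>Subspaces, isomorphisms and \<open>c\<^sub>0(\<Gamma>)\<close>\<close>

definition closed_subspace :: "'a::real_normed_vector set \<Rightarrow> bool" where
  "closed_subspace Y \<longleftrightarrow> subspace Y \<and> closed Y"

text \<open>Only the values of \<open>f\<close> on \<open>S\<close> and of \<open>g\<close> on \<open>T\<close> matter, so linearity is required on
  \<open>S\<close> only. The inverse \<open>g\<close> is then automatically linear on \<open>T\<close>.\<close>

definition isomorphic_subspaces ::
    "'a::real_normed_vector set \<Rightarrow> 'b::real_normed_vector set \<Rightarrow> bool" where
  "isomorphic_subspaces S T \<longleftrightarrow>
     (\<exists>f g. homeomorphism S T f g \<and>
        (\<forall>x\<in>S. \<forall>y\<in>S. f (x + y) = f x + f y) \<and>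
        (\<forall>c. \<forall>x\<in>S. f (c *\<^sub>R x) = c *\<^sub>R f x))"

text \<open>All functions on a discrete space are continuous, so \<open>'i discrete \<Rightarrow>\<^sub>C real\<close> is the space of
  all bounded real functions on the type \<open>'i\<close> with the supremum norm. The space \<open>c\<^sub>0(\<Gamma>)\<close>
  is the subspace of functions that vanish off \<open>\<Gamma>\<close> and are small outside finite sets.\<close>

definition c0 :: "'i set \<Rightarrow> ('i discrete \<Rightarrow>\<^sub>C real) set" where
  "c0 \<Gamma> = {f. (\<forall>i. i \<notin> \<Gamma> \<longrightarrow> apply_bcontfun f (discrete i) = 0) \<and>
             (\<forall>\<epsilon>>0. finite {i. \<epsilon> \<le> \<bar>apply_bcontfun f (discrete i)\<bar>})}"

text \<open>\<^term>\<open>cardSuc natLeq\<close> is a well-order whose order type is the successor cardinal of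
  \<open>\<aleph>\<^sub>0\<close>, that is, the first uncountable ordinal.\<close>

definition omega1 :: "nat set set" where
  "omega1 = Field (cardSuc natLeq)"

section \<open>Norming subspaces of the dual\<close>

definition norming_functional ::
    "('a::real_normed_vector \<Rightarrow>\<^sub>L real) set \<Rightarrow> 'a \<Rightarrow> real" where
  "norming_functional Z x = (SUP z\<in>Z \<inter> cball 0 1. \<bar>blinfun_apply z x\<bar>)"

definition equivalent_norm :: "('a::real_normed_vector \<Rightarrow> real) \<Rightarrow> bool" where
  "equivalent_norm N \<longleftrightarrow>
     (\<forall>x. N x = 0 \<longleftrightarrow> x = 0) \<and>
     (\<forall>x y. N (x + y) \<le> N x + N y) \<and>
     (\<forall>c x. N (c *\<^sub>R x) = \<bar>c\<bar> * N x) \<and>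
     (\<exists>a>0. \<exists>b>0. \<forall>x. a * norm x \<le> N x \<and> N x \<le> b * norm x)"

definition norming :: "('a::real_normed_vector \<Rightarrow>\<^sub>L real) set \<Rightarrow> bool" where
  "norming Z \<longleftrightarrow> equivalent_norm (norming_functional Z)"

section \<open>Set-valued maps and control measures\<close>

text \<open>Set functions are total; only their values on \<open>\<Sigma>\<close> are constrained. Since all series
  below converge in the reals, taking all sets empty gives value \<open>0\<close> at the empty set.\<close>

definition ca :: "'w set set \<Rightarrow> ('w set \<Rightarrow> real) set" where
  "ca \<Sigma> = {\<nu>. \<forall>A::nat \<Rightarrow> 'w set. range A \<subseteq> \<Sigma> \<longrightarrow> disjoint_family A \<longrightarrow>
              (\<lambda>n. \<nu> (A n)) sums \<nu> (\<Union>n. A n)}"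

definition ca_pos :: "'w set set \<Rightarrow> ('w set \<Rightarrow> real) set" where
  "ca_pos \<Sigma> = {\<mu> \<in> ca \<Sigma>. \<forall>A\<in>\<Sigma>. 0 \<le> \<mu> A}"

definition bounded_nonempty :: "'a::real_normed_vector set set" where
  "bounded_nonempty = {C. bounded C \<and> C \<noteq> {}}"

definition support_fun :: "('a::real_normed_vector \<Rightarrow>\<^sub>L real) \<Rightarrow> 'a set \<Rightarrow> real" where
  "support_fun z C = (SUP x\<in>C. blinfun_apply z x)"

definition control_measure ::
    "'w set set \<Rightarrow> ('w set \<Rightarrow> 'a::real_normed_vector set) \<Rightarrow> ('w set \<Rightarrow> real) \<Rightarrow> bool" where
  "control_measure \<Sigma> M \<mu> \<longleftrightarrow> \<mu> \<in> ca_pos \<Sigma> \<and> (\<forall>A\<in>\<Sigma>. \<mu> A = 0 \<longrightarrow> M A = {0})"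

end

(* For z in Z let mu_z be the positive variation of A |-> s(z, M(A)). Since s(z,C) + s(-z,C) >= 0,
   M(A) = {0} as soon as mu_z(A) = 0 for all z in Z, so it suffices to dominate all mu_z by a single
   finite measure. If every disjoint family of sets that are non-null for some mu_z is countable,
   an exhaustion argument does this with countably many of the mu_z. Otherwise there are
   uncountably many disjoint sets A with points 0 <> x_A in M(A), and for every z in Z the sum of all
   |z(x_A)| is bounded by mu_z(Omega) + mu_{-z}(Omega). By uniform boundedness and because Z is
   norming, (x_A) satisfies an upper c_0 estimate; Rosenthal's disjointness argument yields a
   subfamily of size omega_1 that also satisfies a lower one, hence a copy of c_0(omega_1). *)

theory Submission
  imports Defs
begin

section \<open>The positive variation of a signed measure\<close>

text \<open>\<open>M\<close> need not be monotone: for a vector measure m and M(E) = {m(E)}, M(A)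
  can be {0} while M(B) is not for some B \<subseteq> A, because B and A - B cancel. Hence the
  signed measures themselves have the wrong null sets, and their variations take their place.
  One-sided suprema suffice, since Z contains -z along with z. For the same reason the point x_A is
  in fact chosen in M(B) for some measurable B \<subseteq> A; the estimates survive because
  variations are monotone.

  The bound on the sums of |z(x_A)| is at first only pointwise in z. Both c_0 estimates need it
  uniformly on the unit ball of Z, and this is where Baire's theorem uses that Z is norm-closed.

  Choosing a subfamily index by index would easily produce a copy of c_0, but here the subfamily has
  to keep its cardinality. This is why Rosenthal's argument works with blocks of full size and
  transversals instead of a recursive selection.\<close>

definition positive_variation :: "'w set set \<Rightarrow> ('w set \<Rightarrow> real) \<Rightarrow> 'w set \<Rightarrow> real" where
  "positive_variation \<Sigma> \<nu> A = (SUP B\<in>{B\<in>\<Sigma>. B \<subseteq> A}. \<nu> B)"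

lemma ca_sums:
  assumes "\<nu> \<in> ca \<Sigma>" "range A \<subseteq> \<Sigma>" "disjoint_family A"
  shows "(\<lambda>n. \<nu> (A n)) sums \<nu> (\<Union>n. A n)"
  using assms unfolding ca_def by blast

lemma ca_empty:
  assumes "\<nu> \<in> ca \<Sigma>" "{} \<in> \<Sigma>"
  shows "\<nu> {} = 0"
proof -
  have "(\<lambda>n::nat. \<nu> {}) sums \<nu> (\<Union>n::nat. {})"
    using assms by (intro ca_sums) (auto simp: disjoint_family_on_def)
  then show ?thesis
    using sums_summable summable_const_iff by blast
qed

lemma ca_Un:
  assumes "\<nu> \<in> ca \<Sigma>" "{} \<in> \<Sigma>" "A \<in> \<Sigma>" "B \<in> \<Sigma>" "A \<inter> B = {}"
  shows "\<nu> (A \<union> B) = \<nu> A + \<nu> B"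
proof -
  have "(\<lambda>n. \<nu> (binaryset A B n)) sums \<nu> (\<Union>n. binaryset A B n)"
    using assms
    by (intro ca_sums) (auto simp: range_binaryset_eq disjoint_family_on_def binaryset_def)
  moreover have "(\<lambda>n. \<nu> (binaryset A B n)) sums (\<nu> A + \<nu> B)"
    using assms by (intro binaryset_sums ca_empty)
  ultimately show ?thesis
    by (simp add: UN_binaryset_eq sums_unique2)
qed

lemma ca_pos_mono:
  assumes "\<nu> \<in> ca_pos \<Sigma>" "sigma_algebra \<Omega> \<Sigma>" "A \<in> \<Sigma>" "B \<in> \<Sigma>" "A \<subseteq> B"
  shows "\<nu> A \<le> \<nu> B"
proof -
  interpret sigma_algebra \<Omega> \<Sigma> by fact
  have "\<nu> (A \<union> (B - A)) = \<nu> A + \<nu> (B - A)"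
    using assms by (intro ca_Un[of \<nu> \<Sigma>]) (auto simp: ca_pos_def)
  moreover have "A \<union> (B - A) = B" "0 \<le> \<nu> (B - A)"
    using assms by (auto simp: ca_pos_def)
  ultimately show ?thesis by simp
qed

text \<open>If \<nu> were unbounded above, disjoint pieces of absolute measure at least 1 could be
  split off forever, and the series of their measures could not converge.\<close>

lemma (in sigma_algebra) ca_bdd_above:
  assumes \<nu>: "\<nu> \<in> ca M"
  shows "bdd_above (\<nu> ` M)"
proof (rule ccontr)
  assume unb: "\<not> bdd_above (\<nu> ` M)"
  define bad where "bad A \<longleftrightarrow> A \<in> M \<and> \<not> bdd_above (\<nu> ` {B\<in>M. B \<subseteq> A})" for A
  have add: "\<nu> (A \<union> B) = \<nu> A + \<nu> B" if "A \<in> M" "B \<in> M" "A \<inter> B = {}" for A B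
    using that \<nu> by (intro ca_Un[of \<nu> M]) auto
  have "{B\<in>M. B \<subseteq> \<Omega>} = M"
    using sets_into_space by auto
  then have "bad \<Omega>"
    using unb by (simp add: bad_def)
  have step: "\<exists>A'. bad A' \<and> A' \<subseteq> A \<and> 1 \<le> \<bar>\<nu> (A - A')\<bar>" if "bad A" for A
  proof -
    \<comment> \<open>The threshold \<open>1 + \<bar>\<nu> A\<bar>\<close> gives both
      \<open>B\<close> and \<open>A - B\<close> absolute measure at least 1, so whichever half is
      still unbounded can be kept and the other one discarded.\<close>
    have "\<not> (\<forall>y\<in>\<nu> ` {B\<in>M. B \<subseteq> A}. y \<le> 1 + \<bar>\<nu> A\<bar>)"
      using that unfolding bad_def bdd_above_def by blast
    then obtain B where B: "B \<in> M" "B \<subseteq> A" "\<nu> B > 1 + \<bar>\<nu> A\<bar>"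
      by (auto simp: not_le)
    have A: "A \<in> M" using that by (simp add: bad_def)
    have "\<nu> (B \<union> (A - B)) = \<nu> B + \<nu> (A - B)"
      using A B by (intro add) auto
    moreover have "B \<union> (A - B) = A" "A - (A - B) = B" using B by auto
    ultimately have 1: "1 \<le> \<bar>\<nu> (A - B)\<bar>" "1 \<le> \<bar>\<nu> (A - (A - B))\<bar>"
      using B by auto
    have "bad B \<or> bad (A - B)"
    proof (rule ccontr)
      assume "\<not> (bad B \<or> bad (A - B))"
      then have "bdd_above (\<nu> ` {C\<in>M. C \<subseteq> B})" "bdd_above (\<nu> ` {C\<in>M. C \<subseteq> A - B})"
        using A B Diff[OF A B(1)] by (simp_all add: bad_def)
      then obtain b c where "\<forall>y\<in>\<nu> ` {C\<in>M. C \<subseteq> B}. y \<le> b" "\<forall>y\<in>\<nu> ` {C\<in>M. C \<subseteq> A - B}. y \<le> c"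
        unfolding bdd_above_def by blast
      then have b: "\<And>C. C \<in> M \<Longrightarrow> C \<subseteq> B \<Longrightarrow> \<nu> C \<le> b"
        and c: "\<And>C. C \<in> M \<Longrightarrow> C \<subseteq> A - B \<Longrightarrow> \<nu> C \<le> c"
        by blast+
      have "\<nu> C \<le> b + c" if "C \<in> M" "C \<subseteq> A" for C
      proof -
        have "\<nu> ((C \<inter> B) \<union> (C - B)) = \<nu> (C \<inter> B) + \<nu> (C - B)"
          using that B by (intro add) auto
        moreover have "(C \<inter> B) \<union> (C - B) = C" by auto
        moreover have "\<nu> (C \<inter> B) \<le> b" "\<nu> (C - B) \<le> c"
          using that B(1) by (auto intro!: b c)
        ultimately show ?thesis by simp
      qed
      then have "\<not> bad A" by (auto simp: bad_def intro!: bdd_aboveI[of _ "b + c"])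
      then show False using that by simp
    qed
    then show ?thesis using 1 B by (metis Diff_subset)
  qed
  have "\<exists>S. \<forall>n. bad (S n) \<and> S (Suc n) \<subseteq> S n \<and> 1 \<le> \<bar>\<nu> (S n - S (Suc n))\<bar>"
    using step \<open>bad \<Omega>\<close> by (intro dependent_nat_choice) auto
  then obtain S where S: "\<And>n. bad (S n)"
    and dec: "\<And>n. S (Suc n) \<subseteq> S n" and big: "\<And>n. 1 \<le> \<bar>\<nu> (S n - S (Suc n))\<bar>"
    by blast
  have "S n \<subseteq> S m" if "m \<le> n" for m n
    using lift_Suc_antimono_le[of S m n] dec that by blast
  then have sub: "S n \<subseteq> S (Suc m)" if "m < n" for m n
    using that by (meson Suc_leI)
  have "(S m - S (Suc m)) \<inter> (S n - S (Suc n)) = {}" if "m \<noteq> n" for m n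
    using sub[of m n] sub[of n m] that by (cases "m < n") auto
  then have "disjoint_family (\<lambda>n. S n - S (Suc n))"
    unfolding disjoint_family_on_def by blast
  then have "(\<lambda>n. \<nu> (S n - S (Suc n))) sums \<nu> (\<Union>n. S n - S (Suc n))"
    using S by (intro ca_sums[OF \<nu>]) (auto simp: bad_def)
  then have "(\<lambda>n. \<nu> (S n - S (Suc n))) \<longlonglongrightarrow> 0"
    using sums_summable summable_LIMSEQ_zero by blast
  then have "\<forall>\<^sub>F n in sequentially. \<bar>\<nu> (S n - S (Suc n))\<bar> < 1"
    using tendstoD[of "\<lambda>n. \<nu> (S n - S (Suc n))" 0 sequentially 1] by (simp add: dist_real_def)
  then show False
    using big by (auto simp: eventually_sequentially not_less[symmetric])
qed

lemma (in sigma_algebra) positive_variation_upper: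
  assumes "\<nu> \<in> ca M" "B \<in> M" "B \<subseteq> A"
  shows "\<nu> B \<le> positive_variation M \<nu> A"
  unfolding positive_variation_def using assms ca_bdd_above[OF assms(1)]
  by (intro cSUP_upper) (auto intro: bdd_above_mono)

lemma (in sigma_algebra) positive_variation_least:
  assumes "\<And>B. B \<in> M \<Longrightarrow> B \<subseteq> A \<Longrightarrow> \<nu> B \<le> c"
  shows "positive_variation M \<nu> A \<le> c"
  unfolding positive_variation_def using assms by (intro cSUP_least) auto

text \<open>Superadditivity on disjoint sets bounds every finite partial sum by the value on the
  union; cutting a set B into the pieces \<open>B \<inter> A n\<close> gives the reverse inequality.
  The suprema are finite because \<nu> is bounded above.\<close>

lemma (in sigma_algebra) positive_variation_ca_pos:
  assumes \<nu>: "\<nu> \<in> ca M"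
  shows "positive_variation M \<nu> \<in> ca_pos M"
proof -
  let ?P = "positive_variation M \<nu>"
  note upper = positive_variation_upper[OF \<nu>]
  have nonneg: "0 \<le> ?P A" for A
    using upper[of "{}" A] ca_empty[OF \<nu>] by simp
  have super: "?P A + ?P B \<le> ?P (A \<union> B)" if "A \<inter> B = {}" for A B
  proof -
    \<comment> \<open>The two suprema are taken in turn: over \<open>D\<close> for fixed
      \<open>C\<close>, then over \<open>C\<close>.\<close>
    have "\<nu> C \<le> ?P (A \<union> B) - ?P B" if C: "C \<in> M" "C \<subseteq> A" for C
    proof -
      have "\<nu> D \<le> ?P (A \<union> B) - \<nu> C" if D: "D \<in> M" "D \<subseteq> B" for D
      proof -
        have "\<nu> C + \<nu> D = \<nu> (C \<union> D)"
          using C D \<open>A \<inter> B = {}\<close> by (intro ca_Un[OF \<nu>, symmetric]) auto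
        also have "\<dots> \<le> ?P (A \<union> B)"
          using C D by (intro upper) auto
        finally show ?thesis by simp
      qed
      then show ?thesis
        using positive_variation_least[of B \<nu> "?P (A \<union> B) - \<nu> C"] by simp
    qed
    then show ?thesis
      using positive_variation_least[of A \<nu> "?P (A \<union> B) - ?P B"] by simp
  qed
  have "(\<lambda>n. ?P (A n)) sums ?P (\<Union>n. A n)"
    if A: "range A \<subseteq> M" "disjoint_family A" for A :: "nat \<Rightarrow> 'a set"
  proof -
    have le: "(\<Sum>n<N. ?P (A n)) \<le> ?P (\<Union>n. A n)" for N
    proof -
      have "(\<Sum>n<N. ?P (A n)) \<le> ?P (\<Union>n<N. A n)"
      proof (induction N)
        case (Suc N)
        have "A n \<inter> A N = {}" if "n < N" for n
          using A(2) that by (simp add: disjoint_family_on_def)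
        then have "(\<Union>n<N. A n) \<inter> A N = {}"
          by blast
        then have "?P (\<Union>n<N. A n) + ?P (A N) \<le> ?P (\<Union>n<Suc N. A n)"
          using super[of "\<Union>n<N. A n" "A N"] by (simp add: lessThan_Suc Un_commute)
        then show ?case using Suc by simp
      qed (simp add: nonneg)
      also have "\<dots> \<le> ?P (\<Union>n. A n)"
        by (intro positive_variation_least upper) auto
      finally show ?thesis .
    qed
    then have summ: "summable (\<lambda>n. ?P (A n))"
      using nonneg by (intro summableI_nonneg_bounded[of _ "?P (\<Union>n. A n)"]) auto
    have "?P (\<Union>n. A n) \<le> (\<Sum>n. ?P (A n))"
    proof (rule positive_variation_least)
      fix B assume B: "B \<in> M" "B \<subseteq> (\<Union>n. A n)"
      have "(\<lambda>n. \<nu> (B \<inter> A n)) sums \<nu> (\<Union>n. B \<inter> A n)"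
        using A B by (intro ca_sums[OF \<nu>]) (auto simp: disjoint_family_on_def)
      moreover have "(\<Union>n. B \<inter> A n) = B" using B by auto
      moreover have "\<nu> (B \<inter> A n) \<le> ?P (A n)" for n
        using A B by (intro upper) auto
      ultimately show "\<nu> B \<le> (\<Sum>n. ?P (A n))"
        using sums_le[OF _ _ summable_sums[OF summ]] by metis
    qed
    moreover have "(\<Sum>n. ?P (A n)) \<le> ?P (\<Union>n. A n)"
      using suminf_le_const[OF summ] le by blast
    ultimately have "(\<Sum>n. ?P (A n)) = ?P (\<Union>n. A n)"
      by (rule antisym[rotated])
    then show ?thesis
      using summable_sums[OF summ] by simp
  qed
  then show ?thesis
    using nonneg by (auto simp: ca_pos_def ca_def)
qed

section \<open>Dominating families of measures\<close>

lemma (in sigma_algebra) ca_pos_countable_sum: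
  fixes \<mu> :: "'i \<Rightarrow> 'a set \<Rightarrow> real"
  assumes J: "countable J" and \<mu>: "\<And>i. i \<in> J \<Longrightarrow> \<mu> i \<in> ca_pos M"
  obtains \<kappa> where "\<kappa> \<in> ca_pos M" "\<And>A i. A \<in> M \<Longrightarrow> \<kappa> A = 0 \<Longrightarrow> i \<in> J \<Longrightarrow> \<mu> i A = 0"
proof (cases "J = {}")
  case True
  have "(\<lambda>_. 0) \<in> ca_pos M" by (simp add: ca_pos_def ca_def)
  then show ?thesis using that True by auto
next
  case False
  define \<rho> where "\<rho> n = \<mu> (from_nat_into J n)" for n
  have \<rho>: "\<rho> n \<in> ca_pos M" for n
    using \<mu> from_nat_into[OF False] by (auto simp: \<rho>_def)
  \<comment> \<open>Normalising by the total mass makes the n-th term at most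
    \<open>(1 / 2) ^ n\<close> on every measurable set; the added 1 keeps the denominator positive
    when the mass is 0.\<close>
  define w where "w n = (1 / 2) ^ n / (1 + \<rho> n \<Omega>)" for n
  have \<rho>0: "0 \<le> \<rho> n A" if "A \<in> M" for n A
    using \<rho>[of n] that by (simp add: ca_pos_def)
  have w_pos: "0 < w n" for n
    using \<rho>0[of \<Omega> n] by (simp add: w_def)
  then have term0: "0 \<le> w n * \<rho> n A" if "A \<in> M" for n A
    using \<rho>0[OF that] by (simp add: less_imp_le)
  have bound: "w n * \<rho> n A \<le> (1 / 2) ^ n" if "A \<in> M" for n A
  proof -
    have "\<rho> n A \<le> 1 + \<rho> n \<Omega>"
      using ca_pos_mono[OF \<rho> sigma_algebra_axioms that, of \<Omega> n] sets_into_space[OF that] by simp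
    then have "w n * \<rho> n A \<le> w n * (1 + \<rho> n \<Omega>)"
      using w_pos[of n] by (intro mult_left_mono) auto
    also have "\<dots> = (1 / 2) ^ n"
      using \<rho>0[of \<Omega> n] by (simp add: w_def)
    finally show ?thesis .
  qed
  have summ: "summable (\<lambda>n. w n * \<rho> n A)" if "A \<in> M" for A
  proof (rule summable_comparison_test'[of "\<lambda>n. (1 / 2) ^ n" 0])
    show "norm (w n * \<rho> n A) \<le> (1 / 2) ^ n" for n
      using bound[OF that, of n] term0[OF that, of n] by simp
  qed simp
  define \<kappa> where "\<kappa> A = (\<Sum>n. w n * \<rho> n A)" for A
  have "(\<lambda>k. \<kappa> (A k)) sums \<kappa> (\<Union>k. A k)"
    if A: "range A \<subseteq> M" "disjoint_family A" for A
  proof -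
    let ?a = "\<lambda>n K. \<Sum>k<K. w n * \<rho> n (A k)"
    have U: "(\<Union>k. A k) \<in> M" using A by auto
    have term0': "0 \<le> w n * \<rho> n (A k)" for n k
      using A by (intro term0) auto
    have sms: "(\<lambda>k. w n * \<rho> n (A k)) sums (w n * \<rho> n (\<Union>k. A k))" for n
      using ca_sums[of "\<rho> n" M A] \<rho>[of n] A by (intro sums_mult) (auto simp: ca_pos_def)
    have "norm (?a n K) \<le> (1 / 2) ^ n" for n K
    proof -
      have "?a n K \<le> (\<Sum>k. w n * \<rho> n (A k))"
        using sms[of n] term0' by (intro sum_le_suminf) (auto simp: sums_iff)
      also have "\<dots> \<le> (1 / 2) ^ n"
        using sms[of n] bound[OF U, of n] by (simp add: sums_iff)
      finally show ?thesis
        using sum_nonneg[of "{..<K}" "\<lambda>k. w n * \<rho> n (A k)"] term0' by simp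
    qed
    \<comment> \<open>Tannery's theorem interchanges the limit in \<open>K\<close> with the sum over
      \<open>n\<close>; the geometric series dominates uniformly in \<open>K\<close>.\<close>
    then have "((\<lambda>K. \<Sum>n. ?a n K) \<longlonglongrightarrow> (\<Sum>n. w n * \<rho> n (\<Union>k. A k)))"
      using sms unfolding sums_def
      by (intro tannerys_theorem[where M = "\<lambda>n. (1 / 2) ^ n", THEN conjunct2, THEN conjunct2])
        (auto intro!: always_eventually)
    moreover have "(\<Sum>n. ?a n K) = (\<Sum>k<K. \<kappa> (A k))" for K
      unfolding \<kappa>_def using A by (intro suminf_sum summ) auto
    ultimately show ?thesis
      by (simp add: sums_def \<kappa>_def)
  qed
  moreover have "0 \<le> \<kappa> A" if "A \<in> M" for A
    unfolding \<kappa>_def using summ[OF that] term0[OF that] by (intro suminf_nonneg)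
  ultimately have "\<kappa> \<in> ca_pos M" by (simp add: ca_pos_def ca_def)
  moreover have "\<mu> i A = 0" if "A \<in> M" "\<kappa> A = 0" "i \<in> J" for A i
  proof -
    obtain n where n: "i = from_nat_into J n"
      using from_nat_into_surj[OF J \<open>i \<in> J\<close>] by metis
    have "w n * \<rho> n A = 0"
      using that suminf_eq_zero_iff[OF summ[of A] term0[of A]] by (simp add: \<kappa>_def)
    then show ?thesis using w_pos[of n] n by (simp add: \<rho>_def)
  qed
  ultimately show ?thesis using that by blast
qed

text \<open>By Zorn's lemma. Nonemptiness matters at the end: a set disjoint from all members could
  be adjoined, so by maximality it is a member, and being disjoint from itself it would be
  empty.\<close>

lemma maximal_disjoint_subfamily:
  assumes "\<And>A. P A \<Longrightarrow> A \<noteq> {}"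
  obtains \<A> where "\<And>A. A \<in> \<A> \<Longrightarrow> P A" "disjoint \<A>" "\<And>B. P B \<Longrightarrow> \<exists>A\<in>\<A>. A \<inter> B \<noteq> {}"
proof -
  define F where "F = {\<A>. (\<forall>A\<in>\<A>. P A) \<and> disjoint \<A>}"
  have "\<Union>C \<in> F" if "subset.chain F C" for C
  proof -
    have sub: "C \<subseteq> F" and ch: "\<And>X Y. X \<in> C \<Longrightarrow> Y \<in> C \<Longrightarrow> X \<subseteq> Y \<or> Y \<subseteq> X"
      using that by (auto simp: subset_chain_def)
    have "disjoint (\<Union>C)"
    proof (rule disjointI)
      fix a b assume "a \<in> \<Union>C" "b \<in> \<Union>C" "a \<noteq> b"
      then obtain X where "X \<in> C" "a \<in> X" "b \<in> X"
        using ch by blast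
      moreover from this have "disjoint X"
        using sub by (auto simp: F_def)
      ultimately show "a \<inter> b = {}"
        using \<open>a \<noteq> b\<close> by (simp add: disjoint_def)
    qed
    then show ?thesis using sub by (auto simp: F_def)
  qed
  from subset_Zorn'[OF this] obtain \<A> where \<A>: "\<A> \<in> F" and max: "\<And>X. X \<in> F \<Longrightarrow> \<A> \<subseteq> X \<Longrightarrow> X = \<A>"
    by blast
  have "\<exists>A\<in>\<A>. A \<inter> B \<noteq> {}" if "P B" for B
  proof (rule ccontr)
    assume *: "\<not> (\<exists>A\<in>\<A>. A \<inter> B \<noteq> {})"
    then have "insert B \<A> \<in> F"
      using \<A> that by (auto simp: F_def disjoint_def)
    then have "B \<in> \<A>" using max by blast
    then show False using * assms[OF that] by auto
  qed
  then show ?thesis using \<A> that by (auto simp: F_def)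
qed

text \<open>This is the Halmos-Savage argument: a maximal disjoint family of sets on which a single
  \<open>\<mu> i\<close> dominates all others is countable and exhausts everything.\<close>

lemma (in sigma_algebra) ccc_dominating_measure:
  fixes \<mu> :: "'i \<Rightarrow> 'a set \<Rightarrow> real"
  assumes \<mu>: "\<And>i. i \<in> I \<Longrightarrow> \<mu> i \<in> ca_pos M"
    and ccc: "\<And>\<A>. disjoint \<A> \<Longrightarrow> \<A> \<subseteq> M \<Longrightarrow> (\<And>A. A \<in> \<A> \<Longrightarrow> \<exists>i\<in>I. \<mu> i A \<noteq> 0) \<Longrightarrow> countable \<A>"
  obtains \<kappa> where "\<kappa> \<in> ca_pos M" "\<And>A i. A \<in> M \<Longrightarrow> \<kappa> A = 0 \<Longrightarrow> i \<in> I \<Longrightarrow> \<mu> i A = 0"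
proof -
  define null where "null A \<longleftrightarrow> (\<forall>i\<in>I. \<mu> i A = 0)" for A
  \<comment> \<open>On the measurable subsets of a good set, \<mu> i alone already decides which
    sets are null for the whole family.\<close>
  define good where "good i A \<longleftrightarrow> A \<in> M \<and> \<not> null A \<and> (\<forall>B\<in>M. B \<subseteq> A \<longrightarrow> \<mu> i B = 0 \<longrightarrow> null B)" for i A
  have \<mu>ca: "\<mu> i \<in> ca M" if "i \<in> I" for i
    using \<mu>[OF that] by (simp add: ca_pos_def)
  have null_empty: "null {}"
    using ca_empty[OF \<mu>ca] by (auto simp: null_def)
  have zero_mono: "\<mu> i A = 0" if "i \<in> I" "A \<in> M" "B \<in> M" "A \<subseteq> B" "\<mu> i B = 0" for i A B
    using ca_pos_mono[OF \<mu>[OF that(1)] sigma_algebra_axioms, of A B] \<mu>[OF that(1)] that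
    by (auto simp: ca_pos_def intro: order.antisym)
  have zero_UN: "\<mu> i (\<Union>\<A>) = 0"
    if i: "i \<in> I" and "countable \<A>" "\<A> \<subseteq> M" "\<And>A. A \<in> \<A> \<Longrightarrow> \<mu> i A = 0" for i \<A>
  proof -
    \<comment> \<open>The added empty set leaves the union unchanged and makes the enumeration
      meaningful for an empty family too.\<close>
    define A where "A n = from_nat_into (insert {} \<A>) n" for n
    have A_in: "A n \<in> insert {} \<A>" for n
      unfolding A_def by (rule from_nat_into) simp
    have "range A = insert {} \<A>"
      unfolding A_def using that by (intro range_from_nat_into) auto
    then have "\<Union>\<A> = (\<Union>n. disjointed A n)"
      using UN_disjointed_eq[of A] by simp
    moreover have AM: "range A \<subseteq> M"
      using \<open>range A = _\<close> that(3) by simp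
    then have dM: "range (disjointed A) \<subseteq> M" by (rule range_disjointed_sets)
    moreover have "\<mu> i (disjointed A n) = 0" for n
    proof (rule zero_mono[OF i _ _ disjointed_subset])
      show "\<mu> i (A n) = 0"
        using A_in[of n] that(4)[of "A n"] null_empty i by (cases "A n = {}") (simp_all add: null_def)
      show "A n \<in> M" "disjointed A n \<in> M"
        using AM dM by blast+
    qed
    moreover have "(\<lambda>n. \<mu> i (disjointed A n)) sums \<mu> i (\<Union>n. disjointed A n)"
      using dM by (intro ca_sums[OF \<mu>ca[OF i]] disjoint_family_disjointed)
    ultimately show ?thesis by (simp add: sums_0 sums_unique2)
  qed
  have has_good: "\<exists>i\<in>I. \<exists>B\<subseteq>A. good i B" if A: "A \<in> M" "\<not> null A" for A
  proof -
    obtain i where i: "i \<in> I" "\<mu> i A \<noteq> 0" using A by (auto simp: null_def)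
    \<comment> \<open>Remove from \<open>A\<close> a maximal disjoint family of sets that \<mu> i
      does not see but some other measure does. It is countable, so \<mu> i loses no mass, and by
      maximality no such set remains in the rest.\<close>
    obtain \<B> where \<B>: "\<And>B. B \<in> \<B> \<Longrightarrow> B \<in> M \<and> B \<subseteq> A \<and> \<mu> i B = 0 \<and> \<not> null B" "disjoint \<B>"
      and max: "\<And>C. C \<in> M \<and> C \<subseteq> A \<and> \<mu> i C = 0 \<and> \<not> null C \<Longrightarrow> \<exists>B\<in>\<B>. B \<inter> C \<noteq> {}"
      using maximal_disjoint_subfamily[of "\<lambda>B. B \<in> M \<and> B \<subseteq> A \<and> \<mu> i B = 0 \<and> \<not> null B"] null_empty
      by metis
    have cB: "countable \<B>"
      using \<B> by (intro ccc) (auto simp: null_def)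
    then have BM: "\<Union>\<B> \<in> M" using \<B> by (intro countable_Union) auto
    have "\<mu> i (\<Union>\<B>) = 0"
      using \<B> cB i by (intro zero_UN) auto
    moreover have "\<mu> i (\<Union>\<B> \<union> (A - \<Union>\<B>)) = \<mu> i (\<Union>\<B>) + \<mu> i (A - \<Union>\<B>)"
      using BM A by (intro ca_Un[OF \<mu>ca[OF i(1)]]) auto
    moreover have "\<Union>\<B> \<union> (A - \<Union>\<B>) = A" using \<B> by auto
    ultimately have "\<mu> i (A - \<Union>\<B>) \<noteq> 0" using i by simp
    then have "good i (A - \<Union>\<B>)"
      unfolding good_def using A BM i max by (auto simp: null_def)
    then show ?thesis using i by blast
  qed
  obtain \<A> where \<A>: "\<And>A. A \<in> \<A> \<Longrightarrow> \<exists>i\<in>I. good i A" "disjoint \<A>"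
    and max: "\<And>B. \<exists>i\<in>I. good i B \<Longrightarrow> \<exists>A\<in>\<A>. A \<inter> B \<noteq> {}"
  proof (rule maximal_disjoint_subfamily[of "\<lambda>A. \<exists>i\<in>I. good i A"])
    show "A \<noteq> {}" if "\<exists>i\<in>I. good i A" for A
      using that null_empty by (auto simp: good_def)
  qed blast
  have \<A>M: "\<A> \<subseteq> M"
    using \<A>(1) by (auto simp: good_def)
  moreover have "\<exists>i\<in>I. \<mu> i A \<noteq> 0" if "A \<in> \<A>" for A
    using \<A>(1)[OF that] by (auto simp: good_def null_def)
  ultimately have "countable \<A>"
    using \<A>(2) by (intro ccc)
  obtain i where i: "\<And>A. A \<in> \<A> \<Longrightarrow> i A \<in> I \<and> good (i A) A"
    using \<A>(1) by metis
  have mA: "\<mu> j \<in> ca_pos M" if "j \<in> i ` \<A>" for j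
    using that i \<mu> by auto
  obtain \<kappa> where \<kappa>: "\<kappa> \<in> ca_pos M" "\<And>E j. E \<in> M \<Longrightarrow> \<kappa> E = 0 \<Longrightarrow> j \<in> i ` \<A> \<Longrightarrow> \<mu> j E = 0"
    by (rule ca_pos_countable_sum[of "i ` \<A>" \<mu>]) (use \<open>countable \<A>\<close> mA in auto)
  \<comment> \<open>Inside each member of \<A> goodness makes the trace of \<open>E\<close> null.
    Outside the union, a non-null rest would contain a good set, against maximality. Countably many
    null pieces make up \<open>E\<close>.\<close>
  have "null E" if E: "E \<in> M" "\<kappa> E = 0" for E
  proof -
    have 1: "null (E \<inter> A)" if "A \<in> \<A>" for A
    proof -
      have "\<mu> (i A) (E \<inter> A) = 0"
        using that E i[OF that] \<A>M \<kappa>(2)[of E "i A"] by (intro zero_mono[of "i A" "E \<inter> A" E]) auto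
      then show ?thesis
        using i[OF that] that E \<A>M by (auto simp: good_def)
    qed
    have UM: "\<Union>\<A> \<in> M" using \<A>M \<open>countable \<A>\<close> by (intro countable_Union)
    have 2: "null (E - \<Union>\<A>)"
    proof (rule ccontr)
      assume "\<not> null (E - \<Union>\<A>)"
      then obtain j B where "j \<in> I" "B \<subseteq> E - \<Union>\<A>" "good j B"
        using has_good[of "E - \<Union>\<A>"] E UM by auto
      then show False using max[of B] by auto
    qed
    have "\<mu> j (\<Union>(insert (E - \<Union>\<A>) ((\<inter>) E ` \<A>))) = 0" if "j \<in> I" for j
      using 1 2 that E UM \<A>M \<open>countable \<A>\<close> by (intro zero_UN) (auto simp: null_def)
    moreover have "\<Union>(insert (E - \<Union>\<A>) ((\<inter>) E ` \<A>)) = E" by auto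
    ultimately show ?thesis by (simp add: null_def)
  qed
  then show ?thesis using that \<kappa>(1) by (auto simp: null_def)
qed

section \<open>Uniform boundedness and Rosenthal's disjointness lemma\<close>

text \<open>Baire's theorem inside the closed set \<open>Z\<close>, which is completely metrizable:
  some sublevel set \<open>T n\<close> has interior relative to \<open>Z\<close>. Phrased with
  seminorms, it applies directly to finite sums of absolute values.\<close>

lemma uniform_boundedness_subspace:
  fixes p :: "'j \<Rightarrow> 'b::banach \<Rightarrow> real"
  assumes Z: "closed_subspace Z"
    and cont: "\<And>j. j \<in> J \<Longrightarrow> continuous_on UNIV (p j)"
    and triangle: "\<And>j x y. j \<in> J \<Longrightarrow> p j (x - y) \<le> p j x + p j y"
    and scale: "\<And>j c x. j \<in> J \<Longrightarrow> p j (c *\<^sub>R x) = \<bar>c\<bar> * p j x"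
    and bdd: "\<And>z. z \<in> Z \<Longrightarrow> \<exists>b. \<forall>j\<in>J. p j z \<le> b"
  obtains C where "\<And>z j. z \<in> Z \<Longrightarrow> norm z \<le> 1 \<Longrightarrow> j \<in> J \<Longrightarrow> p j z \<le> C"
proof -
  define T where "T n = {z \<in> Z. \<forall>j\<in>J. p j z \<le> real n}" for n
  have subZ: "subspace Z" and clZ: "closed Z"
    using Z by (auto simp: closed_subspace_def)
  have "z \<in> (\<Union>n. T n)" if "z \<in> Z" for z
  proof -
    obtain b where b: "\<forall>j\<in>J. p j z \<le> b" using bdd[OF \<open>z \<in> Z\<close>] by blast
    obtain n where "b \<le> real n" using real_arch_simple by blast
    then have "z \<in> T n" using b \<open>z \<in> Z\<close> by (force simp: T_def)
    then show ?thesis by blast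
  qed
  then have UT: "\<Union>(range T) = Z" by (auto simp: T_def)
  have closedT: "closedin (top_of_set Z) (T n)" for n
  proof -
    have "T n = Z \<inter> (\<Inter>j\<in>J. {z. p j z \<le> real n})" by (auto simp: T_def)
    moreover have "closed (\<Inter>j\<in>J. {z. p j z \<le> real n})"
      using cont by (intro closed_INT ballI closed_Collect_le continuous_on_const)
    ultimately show ?thesis by (simp add: closedin_closed_Int)
  qed
  have "\<exists>n. top_of_set Z interior_of T n \<noteq> {}"
  proof (rule ccontr)
    assume "\<not> ?thesis"
    then have "top_of_set Z interior_of \<Union>(range T) = {}"
      using clZ closedT by (intro Baire_category_alt)
        (auto simp: completely_metrizable_space_euclidean intro!: completely_metrizable_space_closedin)
    moreover have "top_of_set Z interior_of Z = Z"
      using interior_of_topspace[of "top_of_set Z"] by simp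
    ultimately show False using UT subspace_0[OF subZ] by auto
  qed
  then obtain n z0 where "z0 \<in> top_of_set Z interior_of T n" by blast
  then obtain U where U: "open U" "z0 \<in> U" "Z \<inter> U \<subseteq> T n" and "z0 \<in> T n"
    by (auto simp: interior_of_def openin_open)
  then obtain e where e: "e > 0" "cball z0 e \<subseteq> U"
    using open_contains_cball by blast
  \<comment> \<open>Both \<open>z0 + e *\<^sub>R z\<close> and \<open>z0\<close> lie in
    \<open>T n\<close>, and their difference is \<open>e *\<^sub>R z\<close>.\<close>
  have "p j z \<le> 2 * real n / e" if z: "z \<in> Z" "norm z \<le> 1" and j: "j \<in> J" for z j
  proof -
    have "z0 + e *\<^sub>R z \<in> cball z0 e"
      using e z by (simp add: dist_norm)
    moreover have "z0 + e *\<^sub>R z \<in> Z"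
      using subZ z \<open>z0 \<in> T n\<close> by (auto simp: T_def intro!: subspace_add subspace_scale)
    ultimately have "z0 + e *\<^sub>R z \<in> T n"
      using U(3) e(2) by blast
    then have 1: "p j (z0 + e *\<^sub>R z) \<le> real n"
      using j by (simp add: T_def)
    have "e * p j z = p j ((z0 + e *\<^sub>R z) - z0)"
      using scale[OF j, of e z] e by simp
    also have "\<dots> \<le> real n + real n"
      using triangle[OF j, of "z0 + e *\<^sub>R z" z0] 1 \<open>z0 \<in> T n\<close> j by (force simp: T_def)
    finally show ?thesis
      using e by (simp add: field_simps)
  qed
  then show ?thesis using that by blast
qed

text \<open>Either some block \<open>G i\<close> of a partition of \<open>\<Gamma>\<close> into \<open>|\<Gamma>|\<close> blocks of full size works, or
  picking a bad index from every block lowers the bound by \<open>\<delta>\<close>.\<close>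

lemma rosenthal_disjointness:
  fixes a :: "'i \<Rightarrow> 'i \<Rightarrow> real"
  assumes "infinite \<Gamma>" "0 \<le> \<delta>"
    and "\<And>i F. i \<in> \<Gamma> \<Longrightarrow> finite F \<Longrightarrow> F \<subseteq> \<Gamma> - {i} \<Longrightarrow> sum (a i) F \<le> real n * \<delta>"
  shows "\<exists>h \<Gamma>'. \<Gamma>' \<subseteq> \<Gamma> \<and> bij_betw h \<Gamma> \<Gamma>' \<and>
           (\<forall>i\<in>\<Gamma>'. \<forall>F. finite F \<longrightarrow> F \<subseteq> \<Gamma>' - {i} \<longrightarrow> sum (a i) F \<le> \<delta>)"
  using assms(1,3)
\<comment> \<open>The bound is a multiple of \<delta> so that each passage to a transversal lowers
  \<open>n\<close> by one. Since the transversal is in bijection with \<Gamma>, no cardinality is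
  lost on the way.\<close>
proof (induction n arbitrary: \<Gamma>)
  case 0
  then have "\<forall>i\<in>\<Gamma>. \<forall>F. finite F \<longrightarrow> F \<subseteq> \<Gamma> - {i} \<longrightarrow> sum (a i) F \<le> \<delta>"
    using assms(2) by force
  then show ?case using bij_betw_id[of \<Gamma>] by blast
next
  case (Suc n)
  obtain p where p: "bij_betw p \<Gamma> (\<Gamma> \<times> \<Gamma>)"
    using card_of_Times_same_infinite[OF Suc.prems(1)] card_of_ordIso ordIso_symmetric by blast
  define q where "q = inv_into \<Gamma> p"
  have q: "bij_betw q (\<Gamma> \<times> \<Gamma>) \<Gamma>"
    unfolding q_def using p by (rule bij_betw_inv_into)
  have pq: "p (q y) = y" if "y \<in> \<Gamma> \<times> \<Gamma>" for y
    unfolding q_def using p that by (rule bij_betw_inv_into_right)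
  have qp: "q (p g) = g" if "g \<in> \<Gamma>" for g
    unfolding q_def using p that by (rule bij_betw_inv_into_left)
  have p_in: "p g \<in> \<Gamma> \<times> \<Gamma>" if "g \<in> \<Gamma>" for g
    using p that by (rule bij_betwE[THEN bspec])
  have q_in: "q y \<in> \<Gamma>" if "y \<in> \<Gamma> \<times> \<Gamma>" for y
    using q that by (rule bij_betwE[THEN bspec])
  define G where "G i = {g \<in> \<Gamma>. fst (p g) = i}" for i
  show ?case
  proof (cases "\<exists>i\<in>\<Gamma>. \<forall>k\<in>G i. \<forall>F. finite F \<longrightarrow> F \<subseteq> G i - {k} \<longrightarrow> sum (a k) F \<le> \<delta>")
    case True
    then obtain i where i: "i \<in> \<Gamma>"
      "\<forall>k\<in>G i. \<forall>F. finite F \<longrightarrow> F \<subseteq> G i - {k} \<longrightarrow> sum (a k) F \<le> \<delta>" by blast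
    have "bij_betw (\<lambda>g. q (i, g)) \<Gamma> (G i)"
    proof (rule bij_betw_byWitness[where f' = "\<lambda>g. snd (p g)"])
      show "\<forall>g\<in>\<Gamma>. snd (p (q (i, g))) = g" using i pq by simp
      show "\<forall>g\<in>G i. q (i, snd (p g)) = g"
        using qp by (auto simp: G_def)
      show "(\<lambda>g. q (i, g)) ` \<Gamma> \<subseteq> G i"
        using i q_in pq by (auto simp: G_def)
      show "(\<lambda>g. snd (p g)) ` G i \<subseteq> \<Gamma>"
        using p_in by (force simp: G_def mem_Times_iff)
    qed
    moreover have "G i \<subseteq> \<Gamma>" by (auto simp: G_def)
    ultimately show ?thesis using i by blast
  next
    case False
    then have "\<forall>i\<in>\<Gamma>. \<exists>k F. k \<in> G i \<and> finite F \<and> F \<subseteq> G i - {k} \<and> \<delta> < sum (a k) F"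
      by (meson not_le)
    then obtain k F where k: "\<And>i. i \<in> \<Gamma> \<Longrightarrow> k i \<in> G i"
      and F: "\<And>i. i \<in> \<Gamma> \<Longrightarrow> finite (F i)" "\<And>i. i \<in> \<Gamma> \<Longrightarrow> F i \<subseteq> G i - {k i}"
        "\<And>i. i \<in> \<Gamma> \<Longrightarrow> \<delta> < sum (a (k i)) (F i)"
      by metis
    have "inj_on k \<Gamma>"
    proof (rule inj_onI)
      fix i j assume "i \<in> \<Gamma>" "j \<in> \<Gamma>" "k i = k j"
      then show "i = j" using k[of i] k[of j] by (simp add: G_def)
    qed
    then have kb: "bij_betw k \<Gamma> (k ` \<Gamma>)" by (simp add: bij_betw_def)
    have inf: "infinite (k ` \<Gamma>)"
      using Suc.prems(1) bij_betw_finite[OF kb] by simp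
    have "sum (a g) H \<le> real n * \<delta>"
      if g: "g \<in> k ` \<Gamma>" and H: "finite H" "H \<subseteq> k ` \<Gamma> - {g}" for g H
    proof -
      obtain i where i: "i \<in> \<Gamma>" "g = k i" using g by blast
      \<comment> \<open>The blocks are disjoint, so \<open>k l\<close> in \<open>F i\<close> forces
        \<open>l = i\<close>, while \<open>H\<close> omits \<open>k i\<close>. The sum over
        \<open>F i\<close> exceeds \<delta>, which is what the sum over \<open>H\<close> has to give
        up.\<close>
      have disj: "H \<inter> F i = {}"
      proof (rule ccontr)
        assume "H \<inter> F i \<noteq> {}"
        then obtain l where "l \<in> \<Gamma>" "k l \<noteq> k i" "k l \<in> F i" using H i by blast
        moreover have "k l \<in> G i" "k l \<in> G l" using F(2)[OF i(1)] k calculation by blast+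
        ultimately show False by (auto simp: G_def)
      qed
      have "sum (a g) H + sum (a g) (F i) = sum (a g) (H \<union> F i)"
        using H F(1) i disj by (simp add: sum.union_disjoint)
      also have "\<dots> \<le> real (Suc n) * \<delta>"
      proof (rule Suc.prems(2))
        show "g \<in> \<Gamma>" "finite (H \<union> F i)"
          using k[of i] i H F(1) by (auto simp: G_def)
        have "k ` \<Gamma> \<subseteq> \<Gamma>" "G i \<subseteq> \<Gamma>" using k by (auto simp: G_def)
        then show "H \<union> F i \<subseteq> \<Gamma> - {g}" using H F(2)[OF i(1)] i by blast
      qed
      finally show ?thesis using F(3)[OF i(1)] i by (simp add: algebra_simps)
    qed
    from Suc.IH[OF inf this] obtain h \<Gamma>' where h: "\<Gamma>' \<subseteq> k ` \<Gamma>" "bij_betw h (k ` \<Gamma>) \<Gamma>'"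
      "\<forall>i\<in>\<Gamma>'. \<forall>F. finite F \<longrightarrow> F \<subseteq> \<Gamma>' - {i} \<longrightarrow> sum (a i) F \<le> \<delta>" by blast
    have "bij_betw (h \<circ> k) \<Gamma> \<Gamma>'" using kb h(2) by (rule bij_betw_trans)
    moreover have "\<Gamma>' \<subseteq> \<Gamma>" using h(1) k by (auto simp: G_def)
    ultimately show ?thesis using h(3) by blast
  qed
qed

text \<open>Cardinals are comparable and \<open>cardSuc natLeq\<close> is the least one above that
  of the naturals. This replaces an arbitrary uncountable index set by
  \<open>omega1\<close>.\<close>

lemma omega1_injects:
  includes cardinal_syntax
  assumes "uncountable A"
  obtains f where "inj_on f omega1" "f ` omega1 \<subseteq> A"
proof -
  have "\<not> |A| \<le>o |UNIV :: nat set|"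
    using assms unfolding card_of_ordLeq[symmetric] countable_def by blast
  then have "\<not> |A| \<le>o natLeq"
    using ordLeq_ordIso_trans[OF _ ordIso_symmetric[OF card_of_nat]] by blast
  then have "natLeq <o |A|"
    using not_ordLeq_iff_ordLess[OF natLeq_Well_order card_of_Well_order] by blast
  then have "cardSuc natLeq \<le>o |A|"
    using cardSuc_ordLess_ordLeq[OF natLeq_Card_order card_of_Card_order] by blast
  moreover have "|omega1| =o cardSuc natLeq"
    unfolding omega1_def by (intro card_of_Field_ordIso cardSuc_Card_order natLeq_Card_order)
  ultimately have "|omega1| \<le>o |A|"
    using ordIso_ordLeq_trans by blast
  then show ?thesis using that card_of_ordLeq[of omega1 A] by blast
qed

lemma infinite_omega1: "infinite omega1"
  unfolding omega1_def
  using cardSuc_finite[OF natLeq_Card_order] infinite_UNIV_nat by (simp add: Field_natLeq)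

section \<open>Copies of \<open>c\<^sub>0(\<Gamma>)\<close>\<close>

text \<open>Finite sums over sets containing \<open>F0\<close> are within e/2 of the sum over
  \<open>F0\<close>, hence form a Cauchy filter. This handles index sets of any cardinality at
  once.\<close>

lemma summable_on_Cauchy_criterion:
  fixes f :: "'i \<Rightarrow> 'a::banach"
  assumes "\<And>e. e > 0 \<Longrightarrow> \<exists>F0. finite F0 \<and> F0 \<subseteq> A \<and> (\<forall>F. finite F \<longrightarrow> F \<subseteq> A - F0 \<longrightarrow> norm (sum f F) < e)"
  shows "f summable_on A"
proof -
  have "\<exists>P. eventually P (finite_subsets_at_top A) \<and>
          (\<forall>F F'. P F \<and> P F' \<longrightarrow> dist (sum f F) (sum f F') < e)" if "e > 0" for e
  proof -
    obtain F0 where F0: "finite F0" "F0 \<subseteq> A"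
      "\<And>F. finite F \<Longrightarrow> F \<subseteq> A - F0 \<Longrightarrow> norm (sum f F) < e / 2"
      using assms[of "e / 2"] \<open>e > 0\<close> by auto
    define P where "P F \<longleftrightarrow> finite F \<and> F0 \<subseteq> F \<and> F \<subseteq> A" for F
    have near: "dist (sum f F) (sum f F0) < e / 2" if "P F" for F
      using that F0(3)[of "F - F0"] sum_diff[of F F0 f] by (auto simp: P_def dist_norm)
    have "eventually P (finite_subsets_at_top A)"
      unfolding eventually_finite_subsets_at_top using F0 by (auto simp: P_def)
    moreover have "dist (sum f F) (sum f F') < e" if "P F \<and> P F'" for F F'
      using near[of F] near[of F'] that dist_triangle_half_l by blast
    ultimately show ?thesis by blast
  qed
  then have "cauchy_filter (filtermap (sum f) (finite_subsets_at_top A))"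
    by (simp add: cauchy_filter_metric_filtermap)
  moreover have "complete (UNIV :: 'a set)"
    by (meson Cauchy_convergent UNIV_I complete_def convergent_def)
  ultimately obtain L where "(sum f \<longlongrightarrow> L) (finite_subsets_at_top A)"
    using complete_uniform[where S = UNIV] by (force simp add: filterlim_def)
  then show ?thesis
    using summable_on_def has_sum_def by blast
qed

section \<open>Coordinates, closedness and norm attainment in c_0(Gamma)\<close>

abbreviation at_index :: "('i discrete \<Rightarrow>\<^sub>C real) \<Rightarrow> 'i \<Rightarrow> real" where
  "at_index f i \<equiv> apply_bcontfun f (discrete i)"

lemma at_index_le_norm: "\<bar>at_index f i\<bar> \<le> norm f"
  using norm_bounded[of f "discrete i"] by simp

lemma norm_le_at_index:
  assumes "\<And>i. \<bar>at_index f i\<bar> \<le> b"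
  shows "norm f \<le> b"
proof (rule norm_bound)
  show "norm (apply_bcontfun f y) \<le> b" for y
    using assms[of "of_discrete y"] by (simp add: of_discrete_inverse)
qed

lemma at_index_add: "at_index (f + g) i = at_index f i + at_index g i"
  and at_index_scaleR: "at_index (c *\<^sub>R f) i = c * at_index f i"
  and at_index_diff: "at_index (f - g) i = at_index f i - at_index g i"
  by simp_all

lemma c0_vanishes: "f \<in> c0 \<Gamma> \<Longrightarrow> i \<notin> \<Gamma> \<Longrightarrow> at_index f i = 0"
  and c0_finite: "f \<in> c0 \<Gamma> \<Longrightarrow> \<epsilon> > 0 \<Longrightarrow> finite {i. \<epsilon> \<le> \<bar>at_index f i\<bar>}"
  by (auto simp: c0_def)

lemma subspace_c0: "subspace (c0 \<Gamma>)"
proof (rule subspaceI)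
  show "0 \<in> c0 \<Gamma>" by (simp add: c0_def)
next
  fix f g assume fg: "f \<in> c0 \<Gamma>" "g \<in> c0 \<Gamma>"
  have "finite {i. \<epsilon> \<le> \<bar>at_index (f + g) i\<bar>}" if "\<epsilon> > 0" for \<epsilon>
  proof (rule finite_subset)
    show "{i. \<epsilon> \<le> \<bar>at_index (f + g) i\<bar>} \<subseteq> {i. \<epsilon> / 2 \<le> \<bar>at_index f i\<bar>} \<union> {i. \<epsilon> / 2 \<le> \<bar>at_index g i\<bar>}"
      by auto
    show "finite ({i. \<epsilon> / 2 \<le> \<bar>at_index f i\<bar>} \<union> {i. \<epsilon> / 2 \<le> \<bar>at_index g i\<bar>})"
      using fg that by (intro finite_UnI c0_finite) auto
  qed
  then show "f + g \<in> c0 \<Gamma>" using fg by (simp add: c0_def)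
next
  fix f and c :: real assume f: "f \<in> c0 \<Gamma>"
  have "finite {i. \<epsilon> \<le> \<bar>at_index (c *\<^sub>R f) i\<bar>}" if "\<epsilon> > 0" for \<epsilon>
  proof (cases "c = 0")
    case False
    then have "{i. \<epsilon> \<le> \<bar>at_index (c *\<^sub>R f) i\<bar>} = {i. \<epsilon> / \<bar>c\<bar> \<le> \<bar>at_index f i\<bar>}"
      by (auto simp: abs_mult field_simps)
    then show ?thesis using c0_finite[OF f, of "\<epsilon> / \<bar>c\<bar>"] that False by simp
  qed (use that in simp)
  then show "c *\<^sub>R f \<in> c0 \<Gamma>" using f by (simp add: c0_def)
qed

lemma closed_c0: "closed (c0 \<Gamma>)"
proof (unfold closed_sequential_limits, intro allI impI, elim conjE)
  fix F f assume F: "\<forall>n. F n \<in> c0 \<Gamma>" and lim: "F \<longlonglongrightarrow> f"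
  have close: "\<exists>n. norm (F n - f) < e" if "e > 0" for e
    using lim that unfolding LIMSEQ_iff by blast
  have near: "\<bar>at_index f i\<bar> \<le> \<bar>at_index (F n) i\<bar> + norm (F n - f)" for i n
    using at_index_le_norm[of "F n - f" i] by (simp add: at_index_diff)
  have "at_index f i = 0" if "i \<notin> \<Gamma>" for i
  proof (rule ccontr)
    assume "at_index f i \<noteq> 0"
    then obtain n where "norm (F n - f) < \<bar>at_index f i\<bar>" using close[of "\<bar>at_index f i\<bar>"] by auto
    then show False using near[of i n] c0_vanishes[of "F n" \<Gamma> i] F that by simp
  qed
  moreover have "finite {i. \<epsilon> \<le> \<bar>at_index f i\<bar>}" if "\<epsilon> > 0" for \<epsilon>
  proof -
    obtain n where n: "norm (F n - f) < \<epsilon> / 2" using close[of "\<epsilon> / 2"] \<open>\<epsilon> > 0\<close> by auto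
    have "\<epsilon> / 2 \<le> \<bar>at_index (F n) i\<bar>" if "\<epsilon> \<le> \<bar>at_index f i\<bar>" for i
      using near[of i n] n that by simp
    then have "{i. \<epsilon> \<le> \<bar>at_index f i\<bar>} \<subseteq> {i. \<epsilon> / 2 \<le> \<bar>at_index (F n) i\<bar>}"
      by blast
    then show ?thesis
      using c0_finite[of "F n" \<Gamma> "\<epsilon> / 2"] F that by (meson finite_subset half_gt_zero)
  qed
  ultimately show "f \<in> c0 \<Gamma>" by (simp add: c0_def)
qed

text \<open>Only finitely many coordinates are at least as large as a given nonzero one, and the
  largest among them is the largest of all.\<close>

lemma c0_attains_norm:
  assumes f: "f \<in> c0 \<Gamma>" and "f \<noteq> 0"
  obtains j where "j \<in> \<Gamma>" "norm f \<le> \<bar>at_index f j\<bar>"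
proof -
  have "\<exists>i. at_index f i \<noteq> 0"
  proof (rule ccontr)
    assume "\<not> ?thesis"
    then have "norm f \<le> 0" by (intro norm_le_at_index) simp
    then show False using \<open>f \<noteq> 0\<close> by simp
  qed
  then obtain i where i: "at_index f i \<noteq> 0" by blast
  let ?S = "{k. \<bar>at_index f i\<bar> \<le> \<bar>at_index f k\<bar>}"
  have S: "finite ?S" "?S \<noteq> {}"
    using c0_finite[OF f, of "\<bar>at_index f i\<bar>"] i by auto
  then have "Max ((\<lambda>k. \<bar>at_index f k\<bar>) ` ?S) \<in> (\<lambda>k. \<bar>at_index f k\<bar>) ` ?S"
    by (intro Max_in) auto
  then obtain j where "j \<in> ?S" "Max ((\<lambda>k. \<bar>at_index f k\<bar>) ` ?S) = \<bar>at_index f j\<bar>"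
    by blast
  then have j: "j \<in> ?S" "\<And>k. k \<in> ?S \<Longrightarrow> \<bar>at_index f k\<bar> \<le> \<bar>at_index f j\<bar>"
    using S(1) Max_ge[of "(\<lambda>k. \<bar>at_index f k\<bar>) ` ?S"] by (metis finite_imageI image_eqI)+
  have "\<bar>at_index f k\<bar> \<le> \<bar>at_index f j\<bar>" for k
    using j(2)[of k] j(1) by (cases "k \<in> ?S") simp_all
  then have "norm f \<le> \<bar>at_index f j\<bar>" by (intro norm_le_at_index)
  moreover have "j \<in> \<Gamma>" using j i c0_vanishes[OF f] by force
  ultimately show ?thesis using that by blast
qed

text \<open>The upper estimate makes the series defining \<open>T\<close> converge and
  \<open>T\<close> Lipschitz; the lower one makes its inverse Lipschitz and its range closed. It is
  enough to have the lower estimate at a coefficient of maximal modulus, because elements of c_0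
  attain their norm.\<close>

lemma c0_copy_of_equivalent_family:
  fixes x :: "'i \<Rightarrow> 'a::banach"
  assumes upper: "\<And>F a s. finite F \<Longrightarrow> F \<subseteq> \<Gamma> \<Longrightarrow> 0 \<le> s \<Longrightarrow> (\<And>i. i \<in> F \<Longrightarrow> \<bar>a i\<bar> \<le> s) \<Longrightarrow>
                    norm (\<Sum>i\<in>F. a i *\<^sub>R x i) \<le> C * s"
    and lower: "\<And>F a j. finite F \<Longrightarrow> F \<subseteq> \<Gamma> \<Longrightarrow> j \<in> F \<Longrightarrow> (\<And>i. i \<in> F \<Longrightarrow> \<bar>a i\<bar> \<le> \<bar>a j\<bar>) \<Longrightarrow>
                    \<delta> * \<bar>a j\<bar> \<le> norm (\<Sum>i\<in>F. a i *\<^sub>R x i)"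
    and "\<delta> > 0"
  shows "\<exists>Y::'a set. closed_subspace Y \<and> isomorphic_subspaces Y (c0 \<Gamma>)"
proof -
  have C: "0 \<le> C" using upper[of "{}" 1] by simp
  define T where "T f = (\<Sum>\<^sub>\<infinity>i\<in>\<Gamma>. at_index f i *\<^sub>R x i)" for f
  have summ: "(\<lambda>i. at_index f i *\<^sub>R x i) summable_on \<Gamma>" if f: "f \<in> c0 \<Gamma>" for f
  proof (rule summable_on_Cauchy_criterion)
    fix e :: real assume "e > 0"
    \<comment> \<open>Dividing by \<open>C + 1\<close> rather than \<open>C\<close> covers the case
      \<open>C = 0\<close>.\<close>
    define \<eta> where "\<eta> = e / (C + 1)"
    have \<eta>: "\<eta> > 0" "C * \<eta> < e" using \<open>e > 0\<close> C by (auto simp: \<eta>_def field_simps)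
    let ?F0 = "{i. \<eta> \<le> \<bar>at_index f i\<bar>}"
    have "finite ?F0" using c0_finite[OF f \<eta>(1)] .
    moreover have "?F0 \<subseteq> \<Gamma>" using c0_vanishes[OF f] \<eta> by force
    moreover have "norm (\<Sum>i\<in>F. at_index f i *\<^sub>R x i) < e" if F: "finite F" "F \<subseteq> \<Gamma> - ?F0" for F
    proof -
      have "norm (\<Sum>i\<in>F. at_index f i *\<^sub>R x i) \<le> C * \<eta>"
        using F \<eta> by (intro upper) auto
      then show ?thesis using \<eta> by simp
    qed
    ultimately show "\<exists>F0. finite F0 \<and> F0 \<subseteq> \<Gamma> \<and>
        (\<forall>F. finite F \<longrightarrow> F \<subseteq> \<Gamma> - F0 \<longrightarrow> norm (\<Sum>i\<in>F. at_index f i *\<^sub>R x i) < e)"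
      by blast
  qed
  have T_lim: "((\<lambda>F. norm (\<Sum>i\<in>F. at_index f i *\<^sub>R x i)) \<longlongrightarrow> norm (T f)) (finite_subsets_at_top \<Gamma>)"
    if "f \<in> c0 \<Gamma>" for f
    unfolding T_def using infsum_tendsto[OF summ[OF that]] by (rule tendsto_norm)
  have T_upper: "norm (T f) \<le> C * norm f" if f: "f \<in> c0 \<Gamma>" for f
  proof (rule tendsto_upperbound[OF T_lim[OF f]])
    show "\<forall>\<^sub>F F in finite_subsets_at_top \<Gamma>. norm (\<Sum>i\<in>F. at_index f i *\<^sub>R x i) \<le> C * norm f"
      using at_index_le_norm by (intro eventually_finite_subsets_at_top_weakI upper) auto
  qed simp
  have T_lower: "\<delta> * norm f \<le> norm (T f)" if f: "f \<in> c0 \<Gamma>" for f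
  proof (cases "f = 0")
    case False
    then obtain j where j: "j \<in> \<Gamma>" "norm f \<le> \<bar>at_index f j\<bar>"
      using c0_attains_norm[OF f] by blast
    have le: "\<bar>at_index f i\<bar> \<le> \<bar>at_index f j\<bar>" for i
      using at_index_le_norm[of f i] j by simp
    have "\<delta> * \<bar>at_index f j\<bar> \<le> norm (T f)"
    proof (rule tendsto_lowerbound[OF T_lim[OF f]])
      show "\<forall>\<^sub>F F in finite_subsets_at_top \<Gamma>. \<delta> * \<bar>at_index f j\<bar> \<le> norm (\<Sum>i\<in>F. at_index f i *\<^sub>R x i)"
        \<comment> \<open>The lower estimate holds for every finite set containing the norming index
          \<open>j\<close>.\<close>
        unfolding eventually_finite_subsets_at_top
        using j le by (intro exI[of _ "{j}"]) (auto intro!: lower)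
    qed simp
    moreover have "\<delta> * norm f \<le> \<delta> * \<bar>at_index f j\<bar>"
      using j \<open>\<delta> > 0\<close> by simp
    ultimately show ?thesis by simp
  qed simp
  have T_add: "T (f + g) = T f + T g" if "f \<in> c0 \<Gamma>" "g \<in> c0 \<Gamma>" for f g
    unfolding T_def at_index_add scaleR_add_left using that by (intro infsum_add summ)
  have T_scale: "T (c *\<^sub>R f) = c *\<^sub>R T f" for c f
    unfolding T_def at_index_scaleR scaleR_scaleR[symmetric] by (rule infsum_scaleR_right)
  note c0_closed = subspace_add[OF subspace_c0] subspace_scale[OF subspace_c0]
    subspace_diff[OF subspace_c0] subspace_0[OF subspace_c0]
  have T_diff: "T (f - g) = T f - T g" if "f \<in> c0 \<Gamma>" "g \<in> c0 \<Gamma>" for f g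
    using T_add[of "f - g" g] that c0_closed(3)[OF that] by (simp add: eq_diff_eq)
  have dist_upper: "dist (T f) (T g) \<le> C * dist f g"
    and dist_lower: "dist f g \<le> 1 / \<delta> * dist (T f) (T g)" if "f \<in> c0 \<Gamma>" "g \<in> c0 \<Gamma>" for f g
    using T_upper[of "f - g"] T_lower[of "f - g"] T_diff[OF that] c0_closed(3)[OF that] \<open>\<delta> > 0\<close>
    by (simp_all add: dist_norm pos_le_divide_eq mult.commute)
  have inj: "inj_on T (c0 \<Gamma>)"
    using dist_lower by (force intro!: inj_onI)
  define Y where "Y = T ` c0 \<Gamma>"
  define g where "g = inv_into (c0 \<Gamma>) T"
  have gT: "g (T f) = f" if "f \<in> c0 \<Gamma>" for f
    unfolding g_def using inj that by simp
  have Tg: "T (g y) = y" and g_in: "g y \<in> c0 \<Gamma>" if "y \<in> Y" for y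
    using that gT by (auto simp: Y_def)
  have "subspace Y"
  proof (rule subspaceI)
    show "0 \<in> Y"
      using T_scale[of 0 0] c0_closed(4) by (force simp: Y_def)
    show "y + z \<in> Y" if "y \<in> Y" "z \<in> Y" for y z
      using that T_add[symmetric] c0_closed(1)[of _ \<Gamma>] by (auto simp: Y_def)
    show "c *\<^sub>R y \<in> Y" if "y \<in> Y" for c y
      using that T_scale[symmetric] c0_closed(2)[of _ \<Gamma>] by (auto simp: Y_def)
  qed
  moreover have "closed Y"
  proof (unfold closed_sequential_limits, intro allI impI, elim conjE)
    fix y l assume y: "\<forall>n. y n \<in> Y" and lim: "y \<longlonglongrightarrow> l"
    have "Cauchy (\<lambda>n. g (y n))"
    proof (rule metric_CauchyI)
      fix e :: real assume "e > 0"
      then obtain N where N: "\<And>m n. m \<ge> N \<Longrightarrow> n \<ge> N \<Longrightarrow> dist (y m) (y n) < \<delta> * e"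
        using metric_CauchyD[OF LIMSEQ_imp_Cauchy[OF lim], of "\<delta> * e"] \<open>\<delta> > 0\<close> by auto
      have "dist (g (y m)) (g (y n)) < e" if "m \<ge> N" "n \<ge> N" for m n
      proof -
        have "dist (g (y m)) (g (y n)) \<le> 1 / \<delta> * dist (y m) (y n)"
          using dist_lower[of "g (y m)" "g (y n)"] y g_in Tg by simp
        also have "\<dots> < e" using N[OF that] \<open>\<delta> > 0\<close> by (simp add: field_simps)
        finally show ?thesis .
      qed
      then show "\<exists>N. \<forall>m\<ge>N. \<forall>n\<ge>N. dist (g (y m)) (g (y n)) < e" by blast
    qed
    then obtain f where f: "(\<lambda>n. g (y n)) \<longlonglongrightarrow> f"
      using Cauchy_convergent convergent_def by blast
    then have f_in: "f \<in> c0 \<Gamma>"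
      using y g_in by (intro closed_sequentially[OF closed_c0 _ f]) simp
    have "(\<lambda>n. dist (y n) (T f)) \<longlonglongrightarrow> 0"
    proof (rule tendsto_sandwich[where f = "\<lambda>_. 0" and h = "\<lambda>n. C * dist (g (y n)) f"])
      show "\<forall>\<^sub>F n in sequentially. dist (y n) (T f) \<le> C * dist (g (y n)) f"
        using dist_upper[OF g_in f_in] y Tg by (intro always_eventually allI) (metis (no_types))
      show "(\<lambda>n. C * dist (g (y n)) f) \<longlonglongrightarrow> 0"
        using tendsto_mult_right_zero f tendsto_dist_iff by blast
    qed auto
    then have "y \<longlonglongrightarrow> T f" using tendsto_dist_iff by blast
    then have "l = T f" using lim LIMSEQ_unique by blast
    then show "l \<in> Y" using f_in by (simp add: Y_def)
  qed
  moreover have "homeomorphism Y (c0 \<Gamma>) g T"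
  proof (rule homeomorphismI)
    show "continuous_on Y g"
    proof (rule lipschitz_on_continuous_on[OF lipschitz_onI])
      show "dist (g y) (g z) \<le> 1 / \<delta> * dist y z" if "y \<in> Y" "z \<in> Y" for y z
        using dist_lower[of "g y" "g z"] that g_in Tg by simp
    qed (use \<open>\<delta> > 0\<close> in simp)
    show "continuous_on (c0 \<Gamma>) T"
      using dist_upper C by (rule lipschitz_on_continuous_on[OF lipschitz_onI])
  qed (auto simp: Y_def gT)
  moreover have "\<forall>y\<in>Y. \<forall>z\<in>Y. g (y + z) = g y + g z" "\<forall>c. \<forall>y\<in>Y. g (c *\<^sub>R y) = c *\<^sub>R g y"
    using gT T_add[symmetric] T_scale[symmetric] c0_closed(1,2)[of _ \<Gamma>] by (auto simp: Y_def)
  ultimately show ?thesis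
    unfolding closed_subspace_def isomorphic_subspaces_def
    by blast
qed

text \<open>A form of the lower norm estimate that spares later arguments the supremum: pointwise
  bounds on the unit ball of \<open>Z\<close> become norm bounds. That 0 lies in \<open>Z\<close>
  keeps the supremum from being taken over the empty set.\<close>

lemma norming_lower_bound:
  fixes Z :: "('a::real_normed_vector \<Rightarrow>\<^sub>L real) set"
  assumes "norming Z" "subspace Z"
  obtains a where "a > 0"
    "\<And>v K. (\<And>z. z \<in> Z \<Longrightarrow> norm z \<le> 1 \<Longrightarrow> \<bar>blinfun_apply z v\<bar> \<le> K) \<Longrightarrow> a * norm v \<le> K"
proof -
  obtain a where a: "a > 0" "\<And>x. a * norm x \<le> norming_functional Z x"
    using assms(1) by (auto simp: norming_def equivalent_norm_def)
  have "a * norm v \<le> K"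
    if "\<And>z. z \<in> Z \<Longrightarrow> norm z \<le> 1 \<Longrightarrow> \<bar>blinfun_apply z v\<bar> \<le> K" for v K
  proof -
    have "norming_functional Z v \<le> K"
      unfolding norming_functional_def using that subspace_0[OF assms(2)]
      by (intro cSUP_least) auto
    then show ?thesis using a(2)[of v] by simp
  qed
  then show ?thesis using that a(1) by blast
qed

lemma c0_omega1_copy:
  fixes Z :: "('a::banach \<Rightarrow>\<^sub>L real) set" and x :: "'i \<Rightarrow> 'a"
  assumes Z: "closed_subspace Z" "norming Z"
    and "uncountable \<Gamma>" and nonzero: "\<And>i. i \<in> \<Gamma> \<Longrightarrow> x i \<noteq> 0"
    and bdd: "\<And>z. z \<in> Z \<Longrightarrow> \<exists>b. \<forall>F. finite F \<longrightarrow> F \<subseteq> \<Gamma> \<longrightarrow> (\<Sum>i\<in>F. \<bar>blinfun_apply z (x i)\<bar>) \<le> b"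
  shows "\<exists>Y::'a set. closed_subspace Y \<and> isomorphic_subspaces Y (c0 omega1)"
proof -
  have subZ: "subspace Z" using Z by (simp add: closed_subspace_def)
  obtain a where a: "a > 0"
    "\<And>v K. (\<And>z. z \<in> Z \<Longrightarrow> norm z \<le> 1 \<Longrightarrow> \<bar>blinfun_apply z v\<bar> \<le> K) \<Longrightarrow> a * norm v \<le> K"
    using norming_lower_bound[OF Z(2) subZ] by blast
  define J where "J = {F. finite F \<and> F \<subseteq> \<Gamma>}"
  define p where "p F z = (\<Sum>i\<in>F. \<bar>blinfun_apply z (x i)\<bar>)" for F and z :: "'a \<Rightarrow>\<^sub>L real"
  obtain C where C: "\<And>z F. z \<in> Z \<Longrightarrow> norm z \<le> 1 \<Longrightarrow> F \<in> J \<Longrightarrow> p F z \<le> C"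
  proof (rule uniform_boundedness_subspace[OF Z(1), of J p])
    show "continuous_on UNIV (p F)" for F
      unfolding p_def by (intro continuous_intros)
    show "p F (y - z) \<le> p F y + p F z" for F y z
      unfolding p_def sum.distrib[symmetric] blinfun.diff_left by (intro sum_mono abs_triangle_ineq4)
    show "p F (c *\<^sub>R z) = \<bar>c\<bar> * p F z" for F c z
      by (simp add: p_def blinfun.scaleR_left abs_mult sum_distrib_left)
    show "\<exists>b. \<forall>F\<in>J. p F z \<le> b" if "z \<in> Z" for z
      using bdd[OF that] by (auto simp: J_def p_def)
  qed blast
  \<comment> \<open>Rosenthal's lemma will be used with a single \<delta>, so the norms must first
    be bounded away from 0. One of these countably many pieces is still uncountable.\<close>
  define \<Gamma>' where "\<Gamma>' n = {i \<in> \<Gamma>. 1 / real (Suc n) \<le> norm (x i)}" for n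
  have "\<Gamma> \<subseteq> (\<Union>n. \<Gamma>' n)"
  proof
    fix i assume "i \<in> \<Gamma>"
    then obtain n where "1 / real (Suc n) < norm (x i)"
      using nat_approx_posE[of "norm (x i)"] nonzero by auto
    then show "i \<in> (\<Union>n. \<Gamma>' n)" using \<open>i \<in> \<Gamma>\<close> by (auto simp: \<Gamma>'_def intro: less_imp_le)
  qed
  then have "uncountable (\<Union>n. \<Gamma>' n)"
    using \<open>uncountable \<Gamma>\<close> countable_subset by blast
  then obtain m where "uncountable (\<Gamma>' m)"
    by blast
  then obtain f where f: "inj_on f omega1" "f ` omega1 \<subseteq> \<Gamma>' m"
    by (rule omega1_injects)
  \<comment> \<open>With \<open>4 * \<delta> = a / (m + 1)\<close>, norming provides functionals
    exceeding \<open>2 * \<delta>\<close> on the diagonal; at most \<delta> will be lost off it, and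
    \<delta> remains as the lower constant.\<close>
  define \<delta> where "\<delta> = a * (1 / real (Suc m)) / 4"
  have \<delta>: "\<delta> > 0" using a(1) by (simp add: \<delta>_def)
  have "\<exists>z\<in>Z. norm z \<le> 1 \<and> 2 * \<delta> < \<bar>blinfun_apply z (x (f i))\<bar>" if "i \<in> omega1" for i
  proof (rule ccontr)
    assume "\<not> ?thesis"
    then have "a * norm (x (f i)) \<le> 2 * \<delta>"
      by (intro a(2)) (auto simp: not_less)
    moreover have "a * (1 / real (Suc m)) \<le> a * norm (x (f i))"
      using f(2) that a(1) by (intro mult_left_mono) (auto simp: \<Gamma>'_def)
    moreover have "4 * \<delta> = a * (1 / real (Suc m))" by (simp add: \<delta>_def del: of_nat_Suc)
    ultimately have "4 * \<delta> \<le> 2 * \<delta>" by linarith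
    then show False using \<delta> by simp
  qed
  then obtain z where z: "\<And>i. i \<in> omega1 \<Longrightarrow> z i \<in> Z" "\<And>i. i \<in> omega1 \<Longrightarrow> norm (z i) \<le> 1"
    "\<And>i. i \<in> omega1 \<Longrightarrow> 2 * \<delta> < \<bar>blinfun_apply (z i) (x (f i))\<bar>"
    by metis
  obtain N where N: "C \<le> real N * \<delta>"
    using reals_Archimedean3[OF \<delta>] less_imp_le by blast
  have sum_le: "(\<Sum>k\<in>F. \<bar>blinfun_apply w (x (f k))\<bar>) \<le> C"
    if "w \<in> Z" "norm w \<le> 1" "finite F" "F \<subseteq> omega1" for w F
  proof -
    have "(\<Sum>k\<in>F. \<bar>blinfun_apply w (x (f k))\<bar>) = p (f ` F) w"
      unfolding p_def using f(1) that by (subst sum.reindex) (auto intro: inj_on_subset)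
    also have "\<dots> \<le> C" using that f(2) by (intro C) (auto simp: J_def \<Gamma>'_def)
    finally show ?thesis .
  qed
  have "(\<Sum>k\<in>F. \<bar>blinfun_apply (z i) (x (f k))\<bar>) \<le> real N * \<delta>"
    if "i \<in> omega1" "finite F" "F \<subseteq> omega1 - {i}" for i F
    using sum_le[of "z i" F] z that N by fastforce
  from rosenthal_disjointness[OF infinite_omega1 less_imp_le[OF \<delta>],
      of "\<lambda>i k. \<bar>blinfun_apply (z i) (x (f k))\<bar>", OF this]
  obtain h \<Gamma>1 where h: "\<Gamma>1 \<subseteq> omega1" "bij_betw h omega1 \<Gamma>1"
    and small: "\<forall>i\<in>\<Gamma>1. \<forall>F. finite F \<longrightarrow> F \<subseteq> \<Gamma>1 - {i} \<longrightarrow>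
          (\<Sum>k\<in>F. \<bar>blinfun_apply (z i) (x (f k))\<bar>) \<le> \<delta>"
    by blast
  have h_in: "h i \<in> \<Gamma>1" if "i \<in> omega1" for i
    using h(2) that by (rule bij_betwE[THEN bspec])
  have h_inj: "inj_on h F" if "F \<subseteq> omega1" for F
    using h(2) that by (meson bij_betw_imp_inj_on inj_on_subset)
  \<comment> \<open>\<open>\<Gamma>1\<close> is only a subset of \<open>omega1\<close>; composing
    with \<open>h\<close> indexes the subfamily by all of \<open>omega1\<close> again.\<close>
  define y where "y i = x (f (h i))" for i
  show ?thesis
  proof (rule c0_copy_of_equivalent_family[where x = y and C = "C / a" and \<delta> = \<delta>])
    show "\<delta> > 0" by fact
    fix F :: "nat set set" and c :: "nat set \<Rightarrow> real"
    assume F: "finite F" "F \<subseteq> omega1"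
    have sum_h: "(\<Sum>i\<in>G. \<bar>blinfun_apply w (y i)\<bar>) = (\<Sum>k\<in>h ` G. \<bar>blinfun_apply w (x (f k))\<bar>)"
      if "G \<subseteq> F" for w G
      unfolding y_def using h_inj[of G] that F by (subst sum.reindex) auto
    have apply_sum: "blinfun_apply w (\<Sum>i\<in>G. c i *\<^sub>R y i) = (\<Sum>i\<in>G. c i * blinfun_apply w (y i))" for w G
      by (simp add: blinfun.sum_right blinfun.scaleR_right)
    have abs_sum: "\<bar>blinfun_apply w (\<Sum>i\<in>G. c i *\<^sub>R y i)\<bar> \<le> s * (\<Sum>i\<in>G. \<bar>blinfun_apply w (y i)\<bar>)"
      if "\<And>i. i \<in> G \<Longrightarrow> \<bar>c i\<bar> \<le> s" for w G s
    proof -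
      have "\<bar>\<Sum>i\<in>G. c i * blinfun_apply w (y i)\<bar> \<le> (\<Sum>i\<in>G. s * \<bar>blinfun_apply w (y i)\<bar>)"
        using that by (intro order.trans[OF sum_abs] sum_mono) (simp add: abs_mult mult_right_mono)
      then show ?thesis by (simp add: apply_sum sum_distrib_left)
    qed
    show "norm (\<Sum>i\<in>F. c i *\<^sub>R y i) \<le> C / a * s" if s: "0 \<le> s" "\<And>i. i \<in> F \<Longrightarrow> \<bar>c i\<bar> \<le> s" for s
    proof -
      have "a * norm (\<Sum>i\<in>F. c i *\<^sub>R y i) \<le> s * C"
      proof (rule a(2))
        fix w assume w: "w \<in> Z" "norm w \<le> 1"
        have "(\<Sum>i\<in>F. \<bar>blinfun_apply w (y i)\<bar>) \<le> C"
          using w F h(1) h_in by (subst sum_h) (auto intro!: sum_le)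
        then have "s * (\<Sum>i\<in>F. \<bar>blinfun_apply w (y i)\<bar>) \<le> s * C"
          using s(1) by (rule mult_left_mono)
        then show "\<bar>blinfun_apply w (\<Sum>i\<in>F. c i *\<^sub>R y i)\<bar> \<le> s * C"
          using abs_sum[OF s(2)] by (rule order.trans[rotated])
      qed
      then show ?thesis using a(1) by (simp add: field_simps)
    qed
    fix j assume j: "j \<in> F" and max: "\<And>i. i \<in> F \<Longrightarrow> \<bar>c i\<bar> \<le> \<bar>c j\<bar>"
    \<comment> \<open>Test with the functional belonging to \<open>j\<close>: its own term has
      modulus at least \<open>2 * \<delta> * \<bar>c j\<bar>\<close>, and the others add up to at
      most \<open>\<delta> * \<bar>c j\<bar>\<close> because \<open>\<bar>c j\<bar>\<close> is
      maximal.\<close>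
    let ?w = "z (h j)"
    have hj: "h j \<in> \<Gamma>1" "h j \<in> omega1" using j F h_in h(1) by auto
    have "(\<Sum>i\<in>F - {j}. \<bar>blinfun_apply ?w (y i)\<bar>) \<le> \<delta>"
    proof (subst sum_h)
      have "h ` (F - {j}) \<subseteq> \<Gamma>1 - {h j}"
        using h_in F j h_inj[OF F(2)] by (auto dest: inj_onD)
      then show "(\<Sum>k\<in>h ` (F - {j}). \<bar>blinfun_apply ?w (x (f k))\<bar>) \<le> \<delta>"
        using F hj by (intro small[rule_format]) auto
    qed auto
    then have "\<bar>c j\<bar> * (\<Sum>i\<in>F - {j}. \<bar>blinfun_apply ?w (y i)\<bar>) \<le> \<delta> * \<bar>c j\<bar>"
      by (subst mult.commute[of \<delta>], intro mult_left_mono) auto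
    moreover have "\<bar>blinfun_apply ?w (\<Sum>i\<in>F - {j}. c i *\<^sub>R y i)\<bar> \<le>
        \<bar>c j\<bar> * (\<Sum>i\<in>F - {j}. \<bar>blinfun_apply ?w (y i)\<bar>)"
      using max by (intro abs_sum) auto
    moreover have "2 * (\<delta> * \<bar>c j\<bar>) \<le> \<bar>c j * blinfun_apply ?w (y j)\<bar>"
      using mult_left_mono[OF less_imp_le[OF z(3)[OF hj(2)]], of "\<bar>c j\<bar>"]
      by (simp add: y_def abs_mult mult_ac)
    moreover have "blinfun_apply ?w (\<Sum>i\<in>F. c i *\<^sub>R y i) =
        c j * blinfun_apply ?w (y j) + blinfun_apply ?w (\<Sum>i\<in>F - {j}. c i *\<^sub>R y i)"
      unfolding apply_sum using F j by (intro sum.remove)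
    ultimately have "\<delta> * \<bar>c j\<bar> \<le> \<bar>blinfun_apply ?w (\<Sum>i\<in>F. c i *\<^sub>R y i)\<bar>"
      by linarith
    also have "\<dots> \<le> norm ?w * norm (\<Sum>i\<in>F. c i *\<^sub>R y i)"
      using norm_blinfun[of ?w "\<Sum>i\<in>F. c i *\<^sub>R y i"] by simp
    also have "\<dots> \<le> 1 * norm (\<Sum>i\<in>F. c i *\<^sub>R y i)"
      using z(2)[OF hj(2)] by (intro mult_right_mono) auto
    finally show "\<delta> * \<bar>c j\<bar> \<le> norm (\<Sum>i\<in>F. c i *\<^sub>R y i)" by simp
  qed
qed

section \<open>Control measures\<close>

lemma support_fun_upper:
  assumes "C \<in> bounded_nonempty" "x \<in> C"
  shows "blinfun_apply z x \<le> support_fun z C"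
proof -
  have "bounded (blinfun_apply z ` C)"
    using assms(1) by (intro bounded_linear_image) (auto simp: bounded_nonempty_def blinfun.bounded_linear_right)
  then show ?thesis
    unfolding support_fun_def using assms(2) by (intro cSUP_upper bounded_imp_bdd_above)
qed

theorem theorem2:
  fixes \<Omega> :: "'w set" and \<Sigma> :: "'w set set"
    and Z :: "('a::banach \<Rightarrow>\<^sub>L real) set"
    and M :: "'w set \<Rightarrow> 'a set"
  assumes "sigma_algebra \<Omega> \<Sigma>"
    and "\<not> (\<exists>Y::'a set. closed_subspace Y \<and> isomorphic_subspaces Y (c0 omega1))"
    and "closed_subspace Z" and "norming Z"
    and "M \<in> \<Sigma> \<rightarrow> bounded_nonempty"
    and "\<And>z. z \<in> Z \<Longrightarrow> (\<lambda>A. support_fun z (M A)) \<in> ca \<Sigma>"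
  shows "\<exists>\<mu>. control_measure \<Sigma> M \<mu>"
proof -
  interpret S: sigma_algebra \<Omega> \<Sigma> by fact
  define \<mu> where "\<mu> z = positive_variation \<Sigma> (\<lambda>A. support_fun z (M A))" for z
  have \<mu>: "\<mu> z \<in> ca_pos \<Sigma>" if "z \<in> Z" for z
    unfolding \<mu>_def using assms(6)[OF that] by (rule S.positive_variation_ca_pos)
  have subZ: "subspace Z" using assms(3) by (simp add: closed_subspace_def)
  have neg: "- z \<in> Z" if "z \<in> Z" for z
    using subspace_neg[OF subZ that] .
  have bn: "M A \<in> bounded_nonempty" if "A \<in> \<Sigma>" for A
    using assms(5) that by blast
  obtain a where a: "a > 0"
    "\<And>v K. (\<And>z. z \<in> Z \<Longrightarrow> norm z \<le> 1 \<Longrightarrow> \<bar>blinfun_apply z v\<bar> \<le> K) \<Longrightarrow> a * norm v \<le> K"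
    using norming_lower_bound[OF assms(4) subZ] by blast
  have upper: "blinfun_apply z x \<le> \<mu> z A" if "z \<in> Z" "A \<in> \<Sigma>" "B \<in> \<Sigma>" "B \<subseteq> A" "x \<in> M B" for z A B x
    unfolding \<mu>_def
    using support_fun_upper[OF bn[OF that(3)] that(5), of z]
      S.positive_variation_upper[OF assms(6)[OF that(1)] that(3,4)] by simp
  \<comment> \<open>The variations for z and -z bound z(x) from above and from below by 0, and a
    norming \<open>Z\<close> separates x from 0.\<close>
  have zero: "M A = {0}" if A: "A \<in> \<Sigma>" and null: "\<And>z. z \<in> Z \<Longrightarrow> \<mu> z A = 0" for A
  proof -
    have "x = 0" if x: "x \<in> M A" for x
    proof -
      have "a * norm x \<le> 0"
      proof (rule a(2))
        fix z assume z: "z \<in> Z"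
        have "blinfun_apply z x \<le> 0" "blinfun_apply (- z) x \<le> 0"
          using upper[of z A A x] upper[of "- z" A A x] z neg null x A by auto
        then show "\<bar>blinfun_apply z x\<bar> \<le> 0" by (simp add: blinfun.minus_left)
      qed
      then show ?thesis using a(1) by (simp add: mult_le_0_iff)
    qed
    moreover have "M A \<noteq> {}" using bn[OF A] by (simp add: bounded_nonempty_def)
    ultimately show ?thesis by blast
  qed
  \<comment> \<open>If \<open>M\<close> were {0} on all measurable subsets of \<open>A\<close>,
    every support function would vanish there, and so would the variation. The witness
    \<open>B\<close> may be a proper subset, since \<open>M A\<close> itself can be {0}.\<close>
  have nonzero: "\<exists>B\<in>\<Sigma>. B \<subseteq> A \<and> (\<exists>x\<in>M B. x \<noteq> 0)" if A: "A \<in> \<Sigma>" and z: "z \<in> Z" "\<mu> z A \<noteq> 0" for A z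
  proof (rule ccontr)
    assume *: "\<not> ?thesis"
    have 0: "M B = {0}" if "B \<in> \<Sigma>" "B \<subseteq> A" for B
    proof -
      have "M B \<noteq> {}" using bn[OF that(1)] by (simp add: bounded_nonempty_def)
      moreover have "M B \<subseteq> {0}" using * that by blast
      ultimately show ?thesis using subset_singletonD by metis
    qed
    have "\<mu> z A \<le> 0"
      unfolding \<mu>_def using 0 by (intro S.positive_variation_least) (simp add: support_fun_def)
    then show False using \<mu>[OF z(1)] A z(2) by (force simp: ca_pos_def)
  qed
  have ccc: "countable \<A>"
    if \<A>: "disjoint \<A>" "\<A> \<subseteq> \<Sigma>" "\<And>A. A \<in> \<A> \<Longrightarrow> \<exists>z\<in>Z. \<mu> z A \<noteq> 0" for \<A>
  proof (rule ccontr)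
    assume unc: "uncountable \<A>"
    have "\<exists>B x. B \<in> \<Sigma> \<and> B \<subseteq> A \<and> x \<in> M B \<and> x \<noteq> 0" if A: "A \<in> \<A>" for A
    proof -
      obtain z where z: "z \<in> Z" "\<mu> z A \<noteq> 0" using \<A>(3)[OF A] by blast
      have "A \<in> \<Sigma>" using \<A>(2) A by blast
      from nonzero[OF this z] show ?thesis by blast
    qed
    then obtain B x where B: "\<And>A. A \<in> \<A> \<Longrightarrow> B A \<in> \<Sigma>" "\<And>A. A \<in> \<A> \<Longrightarrow> B A \<subseteq> A"
      and x: "\<And>A. A \<in> \<A> \<Longrightarrow> x A \<in> M (B A)" "\<And>A. A \<in> \<A> \<Longrightarrow> x A \<noteq> 0"
      by metis
    have "\<exists>b. \<forall>F. finite F \<longrightarrow> F \<subseteq> \<A> \<longrightarrow> (\<Sum>A\<in>F. \<bar>blinfun_apply z (x A)\<bar>) \<le> b" if z: "z \<in> Z" for z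
    proof (intro exI allI impI)
      fix F assume F: "finite F" "F \<subseteq> \<A>"
      have sum_\<mu>: "(\<Sum>A\<in>F. \<mu> w A) \<le> \<mu> w \<Omega>" if w: "w \<in> Z" for w
      proof -
        have ca: "\<mu> w \<in> ca \<Sigma>" using \<mu>[OF w] by (simp add: ca_pos_def)
        have "(\<Sum>A\<in>F. \<mu> w A) = \<mu> w (\<Union>F) \<and> \<Union>F \<in> \<Sigma>" using F
        proof (induction F rule: finite_induct)
          case empty
          then show ?case using ca_empty[OF ca] by simp
        next
          case (insert A F)
          have "A \<inter> X = {}" if "X \<in> F" for X
            using insert(2,4) that by (intro disjointD[OF \<A>(1)]) auto
          then have "A \<inter> \<Union>F = {}" by blast
          moreover have "A \<in> \<Sigma>" using insert \<A>(2) by auto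
          ultimately show ?case
            using insert ca_Un[OF ca, of A "\<Union>F"] S.Un[of A "\<Union>F"] by simp
        qed
        then show ?thesis
          using ca_pos_mono[OF \<mu>[OF w] assms(1), of "\<Union>F" \<Omega>] S.sets_into_space by auto
      qed
      \<comment> \<open>The modulus is z(x) or (-z)(x). One variation bounds it and the other is
        nonnegative; disjointness then bounds both sums by the total masses, independently of
        \<open>F\<close>.\<close>
      have "(\<Sum>A\<in>F. \<bar>blinfun_apply z (x A)\<bar>) \<le> (\<Sum>A\<in>F. \<mu> z A + \<mu> (- z) A)"
      proof (rule sum_mono)
        fix A assume "A \<in> F"
        then have A: "A \<in> \<A>" "A \<in> \<Sigma>" using F \<A>(2) by auto
        have "0 \<le> \<mu> z A" "0 \<le> \<mu> (- z) A"
          using \<mu>[OF z] \<mu>[OF neg[OF z]] A(2) by (auto simp: ca_pos_def)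
        moreover have "blinfun_apply z (x A) \<le> \<mu> z A" "blinfun_apply (- z) (x A) \<le> \<mu> (- z) A"
          using upper[OF _ A(2) B(1)[OF A(1)] B(2)[OF A(1)] x(1)[OF A(1)]] z neg by auto
        ultimately show "\<bar>blinfun_apply z (x A)\<bar> \<le> \<mu> z A + \<mu> (- z) A"
          by (simp add: blinfun.minus_left)
      qed
      also have "\<dots> \<le> \<mu> z \<Omega> + \<mu> (- z) \<Omega>"
        using sum_\<mu>[OF z] sum_\<mu>[OF neg[OF z]] by (simp add: sum.distrib)
      finally show "(\<Sum>A\<in>F. \<bar>blinfun_apply z (x A)\<bar>) \<le> \<mu> z \<Omega> + \<mu> (- z) \<Omega>" .
    qed
    from c0_omega1_copy[OF assms(3,4) unc x(2) this] show False
      using assms(2) by blast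
  qed
  obtain \<kappa> where "\<kappa> \<in> ca_pos \<Sigma>" "\<And>A z. A \<in> \<Sigma> \<Longrightarrow> \<kappa> A = 0 \<Longrightarrow> z \<in> Z \<Longrightarrow> \<mu> z A = 0"
    by (rule S.ccc_dominating_measure[OF \<mu> ccc]) blast+
  then show ?thesis
    using zero unfolding control_measure_def by blast
qed

end
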